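(* Let each $f_i:\mathbb{R}^p\to\mathbb{R}$ ($i=1,\dots,n$) be coercive and differentiable with $L_{f_i}$-Lipschitz gradient ($L_{f_i}>0$), let $L_f=\max_i L_{f_i}$, and let $W$ be a mixing matrix (see context). Let $0<\alpha<\frac{1+\lambda_n(W)}{L_f}$, let ${\bf x}^0\in\mathbb{R}^{n\times p}$ be arbitrary, and let $\{{\bf x}^k\}$ be the DGD sequence with fixed step size $\alpha$: $${\bf x}^{k+1}=W{\bf x}^k-\alpha\nabla{\bf f}({\bf x}^k),\qquad k=0,1,\dots$$ Let $\mathcal{L}_\alpha({\bf x})={\bf 1}^T{\bf f}({\bf x})+\frac{1}{2\alpha}\|{\bf x}\|_{I-W}^2$. Then: (i) $\{{\bf x}^k\}$ has at least one accumulation point, and any accumulation point ${\bf x}^*$ is a stationary point of $\mathcal{L}_\alpha$, i.e. $\nabla\mathcal{L}_\alpha({\bf x}^* )=0$. (ii) The running best rates of the sequences $\{\|{\bf x}^{k+1}-{\bf x}^k\|^2\}$, $\{\|\nabla\mathcal{L}_\alpha({\bf x}^k)\|^2\}$ and $\{\|\frac1n{\bf 1}^T\nabla{\bf f}({\bf x}^k)\|^2\}$ are $o(\frac1k)$. (iii) $\frac1K\sum_{k=0}^{K-1}\|\frac1n{\bf 1}^T\nabla{\bf f}({\bf x}^k)\|^2=\mathcal{O}(\frac1K)$. (iv) If, in addition, $\mathcal{L}_\alpha$ satisfies the Kurdyka-{\L}ojasiewicz (K{\L}) property at an accumulation point ${\bf x}^*$ of $\{{\bf x}^k\}$, then the whole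 sequence $\{{\bf x}^k\}$ converges to ${\bf x}^*$.
   Context: Notation. $\mathcal{G}=(\mathcal{V},\mathcal{E})$ is a connected undirected graph with $\mathcal{V}=\{1,\dots,n\}$. For ${\bf x}\in\mathbb{R}^{n\times p}$, ${\bf x}_{(i)}\in\mathbb{R}^p$ is its $i$-th row (as a column vector). $\|\cdot\|$ is the Frobenius norm (Euclidean norm for vectors), $\langle\cdot,\cdot\rangle$ the corresponding inner product, and $\|X\|_G^2=\langle X,GX\rangle$ for symmetric positive semidefinite $G\in\mathbb{R}^{n\times n}$. $I$ is the $n\times n$ identity, ${\bf 1}\in\mathbb{R}^n$ the all-ones vector. ${\bf 1}^T{\bf f}({\bf x})=\sum_{i=1}^n f_i({\bf x}_{(i)})$, and $\nabla{\bf f}({\bf x})\in\mathbb{R}^{n\times p}$ is the matrix whose $i$-th row is $\nabla f_i({\bf x}_{(i)})^T$. A function $h$ is coercive if $\|u\|\to\infty$ implies $h(u)\to+\infty$. Mixing matrix: $W=[w_{ij}]\in\mathbb{R}^{n\times n}$ such that (1) $w_{ij}=0$ if $i\ne j$ and $(i,j)\notin\mathcal{E}$, and $w_{ij}>0$ otherwise; (2) $W=W^T$; (3) $\mathrm{null}(I-W)=\mathrm{span}\{{\bf 1}\}$; (4) $I\succeq W\succ -I$. Its eigenvalues are $1=\lambda_1(W)>\lambda_2(W)\ge\dots\ge\lambda_n(W)>-1$. Running best rate: a nonnegative sequence $\{a_k\}$ has running best rate $o(1/k)$ if $b_k=\min\{a_i:i\le k\}$ satisfies $b_k=o(1/k)$.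 K{\L} property: a function $h$ with values in $\mathbb{R}\cup\{+\infty\}$ has the K{\L} property at $x^*\in\mathrm{dom}(\partial h)$ if there exist $\eta\in(0,+\infty]$, a neighborhood $U$ of $x^*$, and a continuous concave function $\varphi:[0,\eta)\to\mathbb{R}_+$ such that (i) $\varphi(0)=0$ and $\varphi$ is differentiable on $(0,\eta)$; (ii) $\varphi'(s)>0$ for all $s\in(0,\eta)$; (iii) for all $x\in U$ with $h(x^* )<h(x)<h(x^* )+\eta$, $\varphi'(h(x)-h(x^* ))\cdot\mathrm{dist}(0,\partial h(x))\ge1$. Here $\partial h$ is the limiting subdifferential ($\{\nabla h\}$ if $h$ is $C^1$), and $\mathbb{R}^{n\times p}$ is identified with $\mathbb{R}^{np}$. *)

theory Defs
  imports "HOL-Analysis.Analysis" "HOL-Library.Landau_Symbols"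
begin

text \<open>
  Elements of \<open>\<real>\<^bsup>n\<times>p\<^esup>\<close> have type \<^typ>\<open>real^'p^'n\<close>. The type \<open>'n\<close> is the vertex set, \<open>x $ i\<close> is
  the \<open>i\<close>-th row, and \<^const>\<open>norm\<close> and \<^const>\<open>inner\<close> on this type are the Frobenius norm and its
  inner product.
\<close>

text \<open>Self-loops are allowed in \<open>E\<close>; they play no role in the definition of a mixing matrix.\<close>

definition connected_undirected_graph :: "('n \<times> 'n) set \<Rightarrow> bool" where
  "connected_undirected_graph E \<longleftrightarrow> sym E \<and> (\<forall>i j. (i, j) \<in> E\<^sup>*)"

definition pos_semidef :: "real^'n^'n \<Rightarrow> bool" where
  "pos_semidef A \<longleftrightarrow> transpose A = A \<and> (\<forall>v. 0 \<le> v \<bullet> (A *v v))"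

definition pos_def :: "real^'n^'n \<Rightarrow> bool" where
  "pos_def A \<longleftrightarrow> transpose A = A \<and> (\<forall>v. v \<noteq> 0 \<longrightarrow> 0 < v \<bullet> (A *v v))"

definition mixing_matrix :: "('n \<times> 'n) set \<Rightarrow> real^'n^'n \<Rightarrow> bool" where
  "mixing_matrix E W \<longleftrightarrow>
     (\<forall>i j. if i \<noteq> j \<and> (i, j) \<notin> E then W $ i $ j = 0 else W $ i $ j > 0) \<and>
     W = transpose W \<and>
     {v. (mat 1 - W) *v v = 0} = span {1} \<and>
     pos_semidef (mat 1 - W) \<and> pos_def (W + mat 1)"

definition eigenvalue :: "real^'n^'n \<Rightarrow> real \<Rightarrow> bool" where
  "eigenvalue A l \<longleftrightarrow> (\<exists>v. v \<noteq> 0 \<and> A *v v = l *\<^sub>R v)"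

text \<open>Used only for symmetric \<open>A\<close>, whose set of real eigenvalues is finite and nonempty.\<close>

definition lambda_min :: "real^'n^'n \<Rightarrow> real" where
  "lambda_min A = Min {l. eigenvalue A l}"

definition gradient :: "('a::real_inner \<Rightarrow> real) \<Rightarrow> 'a \<Rightarrow> 'a" where
  "gradient h x = (THE D. GDERIV h x :> D)"

lemma gradient_eq:
  assumes "GDERIV h x :> D"
  shows "gradient h x = D"
  unfolding gradient_def
proof (rule the_equality)
  show "GDERIV h x :> D" by (fact assms)
next
  fix D' assume "GDERIV h x :> D'"
  then have "(\<lambda>v. v \<bullet> D') = (\<lambda>v. v \<bullet> D)"
    using assms unfolding gderiv_def by (rule has_derivative_unique)
  then have "\<forall>v. v \<bullet> D' = v \<bullet> D" by meson
  then show "D' = D" using vector_eq_ldot by blast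
qed

definition coercive :: "('a::real_normed_vector \<Rightarrow> real) \<Rightarrow> bool" where
  "coercive h \<longleftrightarrow> filterlim h at_top at_infinity"

definition stacked_gradient :: "('n \<Rightarrow> real^'p \<Rightarrow> real) \<Rightarrow> real^'p^'n \<Rightarrow> real^'p^'n" where
  "stacked_gradient f x = (\<chi> i. gradient (f i) (x $ i))"

definition dgd_sequence ::
    "real^'n^'n \<Rightarrow> ('n \<Rightarrow> real^'p \<Rightarrow> real) \<Rightarrow> real \<Rightarrow> (nat \<Rightarrow> real^'p^'n) \<Rightarrow> bool" where
  "dgd_sequence W f \<alpha> x \<longleftrightarrow> (\<forall>k. x (Suc k) = W ** x k - \<alpha> *\<^sub>R stacked_gradient f (x k))"

definition weighted_norm_sq :: "real^'n^'n \<Rightarrow> real^'p^'n \<Rightarrow> real" where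
  "weighted_norm_sq G x = x \<bullet> (G ** x)"

definition lyapunov ::
    "real^'n^'n \<Rightarrow> ('n \<Rightarrow> real^'p \<Rightarrow> real) \<Rightarrow> real \<Rightarrow> real^'p^'n \<Rightarrow> real" where
  "lyapunov W f \<alpha> x =
     (\<Sum>i\<in>UNIV. f i (x $ i)) + 1 / (2 * \<alpha>) * weighted_norm_sq (mat 1 - W) x"

definition average_gradient :: "('n \<Rightarrow> real^'p \<Rightarrow> real) \<Rightarrow> real^'p^'n \<Rightarrow> real^'p" where
  "average_gradient f x = (1 / real CARD('n)) *\<^sub>R (1 v* stacked_gradient f x)"

definition accumulation_point :: "(nat \<Rightarrow> 'a::topological_space) \<Rightarrow> 'a \<Rightarrow> bool" where
  "accumulation_point x l \<longleftrightarrow> (\<exists>r. strict_mono r \<and> (x \<circ> r) \<longlonglongrightarrow> l)"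

definition running_best :: "(nat \<Rightarrow> real) \<Rightarrow> nat \<Rightarrow> real" where
  "running_best a k = Min (a ` {..k})"

definition running_best_rate_o_inverse :: "(nat \<Rightarrow> real) \<Rightarrow> bool" where
  "running_best_rate_o_inverse a \<longleftrightarrow>
     (\<forall>k. 0 \<le> a k) \<and> running_best a \<in> o(\<lambda>k. 1 / real k)"

text \<open>
  Functions with values in \<open>\<real> \<union> {+\<infinity>}\<close> are modelled with \<^typ>\<open>ereal\<close>; the value \<open>-\<infinity>\<close> is excluded
  in the definition of the KL property.
\<close>

definition frechet_subdifferential :: "('a::real_inner \<Rightarrow> ereal) \<Rightarrow> 'a \<Rightarrow> 'a set" where
  "frechet_subdifferential h x =
     {v. \<bar>h x\<bar> \<noteq> \<infinity> \<and>
         0 \<le> Liminf (at x) (\<lambda>y. (h y - h x - ereal (v \<bullet> (y - x))) / ereal (norm (y - x)))}"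

definition limiting_subdifferential :: "('a::real_inner \<Rightarrow> ereal) \<Rightarrow> 'a \<Rightarrow> 'a set" where
  "limiting_subdifferential h x =
     {v. \<bar>h x\<bar> \<noteq> \<infinity> \<and>
         (\<exists>y w. y \<longlonglongrightarrow> x \<and> (\<lambda>k. h (y k)) \<longlonglongrightarrow> h x \<and>
                (\<forall>k. w k \<in> frechet_subdifferential h (y k)) \<and> w \<longlonglongrightarrow> v)}"

text \<open>Unlike \<^const>\<open>infdist\<close>, the distance to the empty set is \<open>+\<infinity>\<close> here.\<close>

definition dist_zero :: "'a::real_normed_vector set \<Rightarrow> ereal" where
  "dist_zero S = (INF v\<in>S. ereal (norm v))"

definition KL_property :: "('a::real_inner \<Rightarrow> ereal) \<Rightarrow> 'a \<Rightarrow> bool" where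
  "KL_property h xs \<longleftrightarrow>
     (\<forall>x. h x \<noteq> -\<infinity>) \<and> limiting_subdifferential h xs \<noteq> {} \<and>
     (\<exists>(\<eta>::ereal) U (\<phi>::real \<Rightarrow> real).
        0 < \<eta> \<and> open U \<and> xs \<in> U \<and>
        continuous_on {s. 0 \<le> s \<and> ereal s < \<eta>} \<phi> \<and>
        concave_on {s. 0 \<le> s \<and> ereal s < \<eta>} \<phi> \<and>
        (\<forall>s. 0 \<le> s \<and> ereal s < \<eta> \<longrightarrow> 0 \<le> \<phi> s) \<and>
        \<phi> 0 = 0 \<and>
        (\<forall>s. 0 < s \<and> ereal s < \<eta> \<longrightarrow> \<phi> differentiable (at s)) \<and>
        (\<forall>s. 0 < s \<and> ereal s < \<eta> \<longrightarrow> 0 < deriv \<phi> s) \<and>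
        (\<forall>x\<in>U. h xs < h x \<and> h x < h xs + \<eta> \<longrightarrow>
           1 \<le> ereal (deriv \<phi> (real_of_ereal (h x - h xs))) *
                 dist_zero (limiting_subdifferential h x)))"

end

theory Submission
  imports Defs
begin

text \<open>
  The idea is that DGD is plain gradient descent on the Lyapunov function: since
  \<open>\<nabla>\<L>\<^sub>\<alpha>(x) = \<nabla>f(x) + (I - W) x / \<alpha>\<close>, the recursion reads \<open>x\<^sup>+ = x - \<alpha> \<nabla>\<L>\<^sub>\<alpha>(x)\<close>. The bound on the
  step size makes this descent strict. The sum of the \<open>f\<^sub>i\<close> satisfies the usual descent lemma with
  constant \<open>L\<^sub>f\<close>, the quadratic penalty is expanded exactly, and with \<open>d = x\<^sup>+ - x\<close> the two give
  \<open>\<L>\<^sub>\<alpha>(x\<^sup>+) \<le> \<L>\<^sub>\<alpha>(x) - (\<parallel>d\<parallel>\<^sup>2 + \<langle>d, W d\<rangle> - \<alpha> L\<^sub>f \<parallel>d\<parallel>\<^sup>2) / (2 \<alpha>)\<close>. By the Rayleigh bound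
  (\<open>lambda_min_inner_le\<close>), the right-hand side is at most \<open>\<L>\<^sub>\<alpha>(x) - c \<parallel>d\<parallel>\<^sup>2\<close> with
  \<open>c = (1 + \<lambda>\<^sub>n - \<alpha> L\<^sub>f) / (2 \<alpha>) > 0\<close>; this is \<open>lyapunov_sufficient_decrease\<close>.

  Everything else is about gradient descent with sufficient decrease and takes place in the
  locale \<open>gradient_descent\<close>. Coercivity keeps the iterates in a bounded sublevel set, so they have
  an accumulation point and the values converge. Telescoping the decrease makes \<open>\<parallel>x\<^sup>k\<^sup>+\<^sup>1 - x\<^sup>k\<parallel>\<^sup>2\<close>
  summable, and hence also its multiple \<open>\<parallel>\<nabla>\<L>\<^sub>\<alpha>(x\<^sup>k)\<parallel>\<^sup>2\<close>. Because the rows of \<open>(I - W) x\<close> sum to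
  zero, the average of \<open>\<nabla>f\<close> is the average of \<open>\<nabla>\<L>\<^sub>\<alpha>\<close> and inherits summability. A nonnegative
  summable sequence has running best rate \<open>o(1/k)\<close> (\<open>summable_imp_running_best_rate\<close>).

  Under the KL property, concavity of the desingularizing function \<open>\<phi>\<close> turns the decrease of the
  gap \<open>e\<^sub>k = \<L>\<^sub>\<alpha>(x\<^sup>k) - \<L>\<^sub>\<alpha>(x\<^sup>*)\<close> into a bound on the length of the step itself:
  \<open>\<phi>(e\<^sub>k) - \<phi>(e\<^sub>k\<^sub>+\<^sub>1) \<ge> \<phi>'(e\<^sub>k) c \<parallel>d\<^sub>k\<parallel>\<^sup>2 \<ge> c \<alpha> \<parallel>d\<^sub>k\<parallel>\<close>. The path that remains after an iterate close to
  \<open>x\<^sup>*\<close> is therefore short, and the sequence can never leave a small ball around \<open>x\<^sup>*\<close> again.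
\<close>

section \<open>The smallest eigenvalue of a symmetric matrix\<close>

lemma symmetric_inner_matrix_vector:
  fixes A :: "real^'n^'n"
  assumes "transpose A = A"
  shows "u \<bullet> (A *v v) = (A *v u) \<bullet> v"
  by (metis assms dot_lmul_matrix transpose_matrix_vector)

text \<open>
  Eigenvectors that belong to distinct eigenvalues are orthogonal, so there are at most as many
  eigenvalues as dimensions.
\<close>

lemma finite_eigenvalues_symmetric:
  fixes A :: "real^'n^'n"
  assumes sym: "transpose A = A"
  shows "finite {l. eigenvalue A l}"
proof -
  define v where "v l = (SOME v. v \<noteq> 0 \<and> A *v v = l *\<^sub>R v)" for l
  have v: "v l \<noteq> 0 \<and> A *v v l = l *\<^sub>R v l" if "eigenvalue A l" for l
    unfolding v_def by (rule someI_ex) (use that in \<open>simp add: eigenvalue_def\<close>)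
  have orth: "v l \<bullet> v m = 0" if "eigenvalue A l" "eigenvalue A m" "l \<noteq> m" for l m
  proof -
    have "m * (v l \<bullet> v m) = l * (v l \<bullet> v m)"
      using symmetric_inner_matrix_vector[OF sym, of "v l" "v m"] v[OF that(1)] v[OF that(2)]
      by simp
    then show ?thesis using that(3) by simp
  qed
  have inj: "inj_on v {l. eigenvalue A l}"
  proof (rule inj_onI, rule ccontr)
    fix l m
    assume lm: "l \<in> {l. eigenvalue A l}" "m \<in> {l. eigenvalue A l}" "v l = v m" "l \<noteq> m"
    then have "v l \<bullet> v l = 0" using orth[of l m] by simp
    then show False using v[of l] lm by simp
  qed
  have "pairwise orthogonal (v ` {l. eigenvalue A l})"
    unfolding pairwise_def orthogonal_def using orth by blast
  moreover have "0 \<notin> v ` {l. eigenvalue A l}" using v by force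
  ultimately have "independent (v ` {l. eigenvalue A l})"
    by (rule pairwise_orthogonal_independent)
  then have "finite (v ` {l. eigenvalue A l})" by (rule finiteI_independent)
  then show ?thesis using inj by (rule finite_imageD)
qed

text \<open>
  A minimizer \<open>v\<close> of the Rayleigh quotient is an eigenvector: the quadratic form \<open>Q\<close> of \<open>A - m I\<close>,
  where \<open>m\<close> is the minimum, is nonnegative and vanishes at \<open>v\<close>, and moving from \<open>v\<close> in the
  direction \<open>-(A v - m v)\<close> would make it negative if that vector were not 0.
\<close>

lemma ex_eigenvalue_le_rayleigh:
  fixes A :: "real^'n^'n"
  assumes sym: "transpose A = A"
  shows "\<exists>m. eigenvalue A m \<and> (\<forall>u. m * (u \<bullet> u) \<le> u \<bullet> (A *v u))"
proof -
  have "continuous_on (sphere 0 1) (\<lambda>u :: real^'n. u \<bullet> (A *v u))"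
    by (intro continuous_intros matrix_vector_mult_linear_continuous_on)
  moreover have "sphere (0 :: real^'n) 1 \<noteq> {}"
    by simp
  ultimately obtain v :: "real^'n" where v: "v \<in> sphere 0 1"
    and min: "\<forall>u\<in>sphere 0 1. v \<bullet> (A *v v) \<le> u \<bullet> (A *v u)"
    using continuous_attains_inf[OF compact_sphere] by blast
  define m where "m = v \<bullet> (A *v v)"
  have vv: "v \<bullet> v = 1" using v by (simp add: norm_eq_1)
  have ray: "m * (u \<bullet> u) \<le> u \<bullet> (A *v u)" for u
  proof (cases "u = 0")
    case False
    have "u /\<^sub>R norm u \<in> sphere 0 1" using False by simp
    then have "m \<le> (u /\<^sub>R norm u) \<bullet> (A *v (u /\<^sub>R norm u))"
      using min m_def by blast
    also have "\<dots> = (u \<bullet> (A *v u)) / (norm u)\<^sup>2"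
      by (simp add: matrix_vector_mult_scaleR power2_eq_square field_simps)
    finally show ?thesis using False by (simp add: field_simps power2_norm_eq_inner)
  qed simp
  define Q where "Q u = u \<bullet> (A *v u) - m * (u \<bullet> u)" for u
  define w where "w = A *v v - m *\<^sub>R v"
  \<comment> \<open>Close to the minimizer of \<open>t \<mapsto> 2 t (w \<bullet> w) + t\<^sup>2 Q w\<close>; the summand 1 covers the case \<open>Q w = 0\<close>.\<close>
  define t where "t = - (w \<bullet> w) / (Q w + 1)"
  have Qw: "0 \<le> Q w" using ray[of w] by (simp add: Q_def)
  have "Q (v + t *\<^sub>R w) = 2 * t * (w \<bullet> w) + t\<^sup>2 * Q w"
  proof -
    have "w \<bullet> (A *v v) - m * (w \<bullet> v) = w \<bullet> w"
      by (simp add: w_def inner_diff_left inner_diff_right)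
    moreover have "v \<bullet> (A *v w) = w \<bullet> (A *v v)"
      using symmetric_inner_matrix_vector[OF sym, of v w] by (simp add: inner_commute)
    moreover have "v \<bullet> (A *v v) = m" by (simp add: m_def)
    ultimately show ?thesis
      unfolding Q_def
      by (simp add: matrix_vector_right_distrib matrix_vector_mult_scaleR inner_add_left
          inner_add_right vv inner_commute[of v w] power2_eq_square algebra_simps)
  qed
  moreover have "0 \<le> Q (v + t *\<^sub>R w)"
    using ray[of "v + t *\<^sub>R w"] by (simp add: Q_def)
  moreover have "2 * t * (w \<bullet> w) + t\<^sup>2 * Q w = - ((w \<bullet> w) / (Q w + 1))\<^sup>2 * (Q w + 2)"
    using Qw by (simp add: t_def power2_eq_square divide_simps) algebra
  ultimately have "((w \<bullet> w) / (Q w + 1))\<^sup>2 * (Q w + 2) \<le> 0" by simp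
  then have "((w \<bullet> w) / (Q w + 1))\<^sup>2 \<le> 0"
    using Qw by (simp add: mult_le_0_iff)
  then have "w = 0" using Qw by auto
  then have "eigenvalue A m"
    unfolding eigenvalue_def w_def using vv by (intro exI[of _ v]) auto
  then show ?thesis using ray by blast
qed

lemma lambda_min_inner_le:
  fixes A :: "real^'n^'n"
  assumes sym: "transpose A = A"
  shows "lambda_min A * (u \<bullet> u) \<le> u \<bullet> (A *v u)"
proof -
  obtain m where m: "eigenvalue A m" "\<And>u. m * (u \<bullet> u) \<le> u \<bullet> (A *v u)"
    using ex_eigenvalue_le_rayleigh[OF sym] by blast
  have "lambda_min A \<le> m"
    unfolding lambda_min_def using finite_eigenvalues_symmetric[OF sym] m(1) by (intro Min_le) auto
  then have "lambda_min A * (u \<bullet> u) \<le> m * (u \<bullet> u)"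
    by (simp add: mult_right_mono)
  then show ?thesis using m(2)[of u] by linarith
qed

section \<open>The Frobenius inner product\<close>

text \<open>
  Splitting the Frobenius product into columns transfers facts about \<open>A\<close> acting on vectors to \<open>A\<close>
  acting on \<open>n \<times> p\<close> matrices.
\<close>

lemma inner_eq_sum_columns:
  fixes X Y :: "real^'p^'n"
  shows "X \<bullet> Y = (\<Sum>j\<in>UNIV. column j X \<bullet> column j Y)"
  unfolding inner_vec_def column_def by simp (rule sum.swap)

lemma column_matrix_matrix_mult: "column j (A ** X) = A *v column j X"
  by (simp add: column_def matrix_matrix_mult_def matrix_vector_mult_def vec_eq_iff)

lemma symmetric_inner_matrix_matrix:
  fixes A :: "real^'n^'n" and X Y :: "real^'p^'n"
  assumes "transpose A = A"
  shows "X \<bullet> (A ** Y) = (A ** X) \<bullet> Y"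
  unfolding inner_eq_sum_columns column_matrix_matrix_mult
  using symmetric_inner_matrix_vector[OF assms] by simp

lemma lambda_min_frobenius_le:
  fixes A :: "real^'n^'n" and X :: "real^'p^'n"
  assumes "transpose A = A"
  shows "lambda_min A * (norm X)\<^sup>2 \<le> X \<bullet> (A ** X)"
  unfolding power2_norm_eq_inner inner_eq_sum_columns column_matrix_matrix_mult sum_distrib_left
  by (rule sum_mono) (rule lambda_min_inner_le[OF assms])

lemma weighted_norm_sq_nonneg:
  assumes "pos_semidef G"
  shows "0 \<le> weighted_norm_sq G X"
  unfolding weighted_norm_sq_def inner_eq_sum_columns column_matrix_matrix_mult
  by (rule sum_nonneg) (use assms in \<open>auto simp: pos_semidef_def\<close>)

lemma transpose_mat_1_minus:
  fixes W :: "real^'n^'n"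
  assumes "transpose W = W"
  shows "transpose (mat 1 - W) = mat 1 - W"
  using assms by (simp add: transpose_def vec_eq_iff mat_def)

lemma mat_1_minus_mult:
  fixes W :: "real^'n^'n" and Z :: "real^'p^'n"
  shows "(mat 1 - W) ** Z = Z - W ** Z"
  by (simp add: matrix_matrix_mult_def vec_eq_iff mat_def left_diff_distrib sum_subtractf
      if_distrib[of "\<lambda>a. a * _"] cong: if_cong)

lemma linear_matrix_matrix_mult: "linear (\<lambda>X :: real^'p^'n. (A :: real^'n^'n) ** X)"
  by (rule linearI)
    (simp_all add: matrix_add_ldistrib matrix_matrix_mult_def vec_eq_iff sum_distrib_left
      sum.distrib algebra_simps)

lemma weighted_norm_sq_add:
  assumes sym: "transpose G = G"
  shows "weighted_norm_sq G (X + D) =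
    weighted_norm_sq G X + 2 * (D \<bullet> (G ** X)) + weighted_norm_sq G D"
  using symmetric_inner_matrix_matrix[OF sym, of X D]
  by (simp add: weighted_norm_sq_def matrix_add_ldistrib inner_add_left inner_add_right
      inner_commute algebra_simps)

lemma GDERIV_weighted_norm_sq:
  fixes G :: "real^'n^'n" and X :: "real^'p^'n"
  assumes sym: "transpose G = G"
  shows "GDERIV (weighted_norm_sq G) X :> 2 *\<^sub>R (G ** X)"
proof -
  have "bounded_linear (\<lambda>X :: real^'p^'n. G ** X)"
    using linear_matrix_matrix_mult linear_conv_bounded_linear by blast
  then have "((\<lambda>X. G ** X) has_derivative (\<lambda>V. G ** V)) (at X)"
    by (rule bounded_linear_imp_has_derivative)
  then have "((\<lambda>X. X \<bullet> (G ** X)) has_derivative (\<lambda>V. X \<bullet> (G ** V) + V \<bullet> (G ** X))) (at X)"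
    by (auto intro!: derivative_eq_intros)
  moreover have "(\<lambda>V. X \<bullet> (G ** V) + V \<bullet> (G ** X)) = (\<lambda>V. V \<bullet> (2 *\<^sub>R (G ** X)))"
    using symmetric_inner_matrix_matrix[OF sym, of X] by (auto simp: inner_commute)
  ultimately show ?thesis unfolding gderiv_def weighted_norm_sq_def by simp
qed

section \<open>Gradients and the descent lemma\<close>

lemma differentiable_imp_GDERIV:
  fixes h :: "'a::euclidean_space \<Rightarrow> real"
  assumes "h differentiable (at u)"
  shows "GDERIV h u :> gradient h u"
proof -
  obtain h' where h': "(h has_derivative h') (at u)"
    using assms differentiable_def by blast
  then have lin: "linear h'" by (rule has_derivative_linear)
  have "h' = (\<lambda>v. v \<bullet> adjoint h' 1)"
    using adjoint_works[OF lin, of _ 1] by auto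
  then have "GDERIV h u :> adjoint h' 1"
    using h' unfolding gderiv_def by simp
  then show ?thesis using gradient_eq by metis
qed

text \<open>
  The difference of the two sides, restricted to the segment from \<open>u\<close> to \<open>v\<close>, has a nonpositive
  derivative.
\<close>

lemma lipschitz_gradient_descent_lemma:
  fixes h :: "'a::real_inner \<Rightarrow> real"
  assumes grad: "\<And>z. GDERIV h z :> g z" and lip: "L-lipschitz_on UNIV g"
  shows "h v \<le> h u + (v - u) \<bullet> g u + L / 2 * (norm (v - u))\<^sup>2"
proof -
  define d where "d = v - u"
  define F where "F t = h (u + t *\<^sub>R d) - t * (d \<bullet> g u) - L / 2 * t\<^sup>2 * (norm d)\<^sup>2" for t :: real
  have deriv: "(F has_real_derivative (d \<bullet> g (u + t *\<^sub>R d) - d \<bullet> g u - L * t * (norm d)\<^sup>2)) (at t)"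
    for t
  proof -
    have "((\<lambda>t. u + t *\<^sub>R d) has_derivative (\<lambda>s. s *\<^sub>R d)) (at t)"
      by (auto intro!: derivative_eq_intros)
    moreover have "(h has_derivative (\<lambda>w. w \<bullet> g (u + t *\<^sub>R d))) (at (u + t *\<^sub>R d))"
      using grad unfolding gderiv_def .
    ultimately have "((\<lambda>t. h (u + t *\<^sub>R d)) has_derivative (\<lambda>s. (s *\<^sub>R d) \<bullet> g (u + t *\<^sub>R d))) (at t)"
      by (rule has_derivative_compose)
    then have "((\<lambda>t. h (u + t *\<^sub>R d)) has_real_derivative d \<bullet> g (u + t *\<^sub>R d)) (at t)"
      unfolding has_field_derivative_def by (simp add: mult_commute_abs)
    then show ?thesis
      unfolding F_def by (auto intro!: derivative_eq_intros)
  qed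
  have "d \<bullet> g (u + t *\<^sub>R d) - d \<bullet> g u - L * t * (norm d)\<^sup>2 \<le> 0" if "0 \<le> t" for t
  proof -
    have "d \<bullet> (g (u + t *\<^sub>R d) - g u) \<le> norm d * norm (g (u + t *\<^sub>R d) - g u)"
      by (rule norm_cauchy_schwarz)
    also have "\<dots> \<le> norm d * (L * norm (t *\<^sub>R d))"
      using lipschitz_onD[OF lip, of "u + t *\<^sub>R d" u]
      by (intro mult_left_mono) (simp_all add: dist_norm)
    also have "\<dots> = L * t * (norm d)\<^sup>2"
      using that by (simp add: power2_eq_square)
    finally show ?thesis by (simp add: inner_diff_right)
  qed
  then have "\<exists>y. (F has_real_derivative y) (at t) \<and> y \<le> 0" if "0 \<le> t" for t
    using deriv that by blast
  then have "F 1 \<le> F 0" by (intro DERIV_nonpos_imp_nonincreasing[of 0 1 F]) simp_all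
  then show ?thesis by (simp add: F_def d_def)
qed

text \<open>
  For a differentiable function, the expression under the lower limit in the definition of the
  Frechet subdifferential tends to 0 at the gradient.
\<close>

lemma gradient_in_limiting_subdifferential:
  fixes h :: "'a::real_inner \<Rightarrow> real"
  assumes "GDERIV h z :> D"
  shows "D \<in> limiting_subdifferential (\<lambda>z. ereal (h z)) z"
proof -
  have "((\<lambda>y. \<bar>(h y - h z - (y - z) \<bullet> D) / norm (y - z)\<bar>) \<longlongrightarrow> 0) (at z)"
    using assms unfolding gderiv_def has_derivative_iff_norm by (simp add: abs_divide)
  then have "((\<lambda>y. (h y - h z - (y - z) \<bullet> D) / norm (y - z)) \<longlongrightarrow> 0) (at z)"
    by (simp only: tendsto_rabs_zero_iff)
  then have "((\<lambda>y. ereal ((h y - h z - D \<bullet> (y - z)) / norm (y - z))) \<longlongrightarrow> 0) (at z)"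
    by (simp add: zero_ereal_def inner_commute)
  moreover have "\<forall>\<^sub>F y in at z. ereal ((h y - h z - D \<bullet> (y - z)) / norm (y - z)) =
      (ereal (h y) - ereal (h z) - ereal (D \<bullet> (y - z))) / ereal (norm (y - z))"
    by (rule eventually_at_filter[THEN iffD2]) (auto intro!: always_eventually)
  ultimately have *: "((\<lambda>y. (ereal (h y) - ereal (h z) - ereal (D \<bullet> (y - z))) /
      ereal (norm (y - z))) \<longlongrightarrow> 0) (at z)"
    using tendsto_cong by fast
  \<comment> \<open>In the zero space the punctured neighbourhood filter is trivial, and the lower limit is \<open>\<infinity>\<close>.\<close>
  have "0 \<le> Liminf (at z) (\<lambda>y. (ereal (h y) - ereal (h z) - ereal (D \<bullet> (y - z))) /
      ereal (norm (y - z)))"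
  proof (cases "at z = bot")
    case False
    then show ?thesis using lim_imp_Liminf[OF _ *] by simp
  qed (simp add: Liminf_bot)
  then have "D \<in> frechet_subdifferential (\<lambda>z. ereal (h z)) z"
    by (simp add: frechet_subdifferential_def)
  then show ?thesis
    unfolding limiting_subdifferential_def
    by (intro CollectI conjI exI[of _ "\<lambda>_. z"] exI[of _ "\<lambda>_. D"]) simp_all
qed

section \<open>Running best rate of summable sequences\<close>

text \<open>
  The running best at time \<open>k\<close> is at most the average over the second half of \<open>{..<k}\<close>, which has at
  least \<open>k/2\<close> terms and whose sum is a Cauchy tail.
\<close>

lemma summable_imp_running_best_rate:
  assumes nonneg: "\<And>k. 0 \<le> a k" and sum: "summable a"
  shows "running_best_rate_o_inverse a"
proof -
  have best_le: "running_best a k \<le> a i" if "i \<le> k" for i k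
    unfolding running_best_def using that by (intro Min_le) auto
  have best_nonneg: "0 \<le> running_best a k" for k
    unfolding running_best_def using nonneg by (subst Min_ge_iff) auto
  have "running_best a \<in> o(\<lambda>k. 1 / real k)"
  proof (rule landau_o.smallI)
    fix c :: real assume "0 < c"
    then obtain N where N: "\<And>m n. N \<le> m \<Longrightarrow> norm (sum a {m..<n}) < c / 2"
      using sum unfolding summable_Cauchy by (meson half_gt_zero)
    have "norm (running_best a k) \<le> c * norm (1 / real k)" if k: "2 * N + 1 \<le> k" for k
    proof -
      define m where "m = k div 2"
      have m: "N \<le> m" "m \<le> k" "real k / 2 \<le> real (k - m)" using k unfolding m_def by linarith+
      have "real k / 2 * running_best a k \<le> real (k - m) * running_best a k"
        using m(3) best_nonneg by (rule mult_right_mono)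
      also have "\<dots> = (\<Sum>i\<in>{m..<k}. running_best a k)" by simp
      also have "\<dots> \<le> sum a {m..<k}" using best_le by (intro sum_mono) auto
      also have "\<dots> < c / 2" using N[OF m(1), of k] by simp
      finally have "real k * running_best a k \<le> c" by simp
      then show ?thesis using k best_nonneg[of k] by (simp add: field_simps)
    qed
    then show "\<forall>\<^sub>F k in sequentially. norm (running_best a k) \<le> c * norm (1 / real k)"
      unfolding eventually_sequentially by blast
  qed
  then show ?thesis using nonneg by (simp add: running_best_rate_o_inverse_def)
qed

lemma summable_imp_average_bigo:
  fixes a :: "nat \<Rightarrow> real"
  assumes nonneg: "\<And>k. 0 \<le> a k" and sum: "summable a"
  shows "(\<lambda>K. 1 / real K * (\<Sum>k<K. a k)) \<in> O(\<lambda>K. 1 / real K)"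
proof (rule bigoI)
  have "norm (1 / real K * (\<Sum>k<K. a k)) \<le> suminf a * norm (1 / real K)" for K
    using sum_le_suminf[OF sum, of "{..<K}"] nonneg sum_nonneg[of "{..<K}" a]
    by (auto simp: abs_mult divide_right_mono)
  then show "\<forall>\<^sub>F K in sequentially. norm (1 / real K * (\<Sum>k<K. a k)) \<le> suminf a * norm (1 / real K)"
    by simp
qed

section \<open>Gradient descent with sufficient decrease\<close>

text \<open>
  A concave function lies below its tangents. Both points are kept away from 0, where the
  desingularizing function need not be differentiable.
\<close>

lemma concave_deriv_mult_diff_le:
  fixes \<phi> :: "real \<Rightarrow> real" and \<eta> :: ereal
  assumes conc: "concave_on {s. 0 \<le> s \<and> ereal s < \<eta>} \<phi>"
    and diff: "\<phi> differentiable (at s)"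
    and st: "0 < t" "t \<le> s" "ereal s < \<eta>"
  shows "deriv \<phi> s * (s - t) \<le> \<phi> s - \<phi> t"
proof -
  let ?A = "{s. 0 < s \<and> ereal s < \<eta>}"
  have "?A = {0<..} \<inter> ereal -` {..<\<eta>}" by auto
  moreover have "open (ereal -` {..<\<eta>})"
    by (intro open_vimage continuous_intros)
  ultimately have op: "open ?A" by (simp add: open_Int)
  have ival: "is_interval ?A"
    unfolding is_interval_1 by simp (meson ereal_less_eq(3) le_less_trans less_le_trans)
  have "convex_on ?A (\<lambda>s. - \<phi> s)"
    using conc unfolding concave_on_def
    by (rule convex_on_subset) (use ival in \<open>auto simp: is_interval_convex\<close>)
  moreover have "(\<phi> has_field_derivative deriv \<phi> s) (at s)"
    using diff by (simp add: DERIV_deriv_iff_real_differentiable)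
  then have "((\<lambda>s. - \<phi> s) has_field_derivative - deriv \<phi> s) (at s within ?A)"
    by (intro DERIV_minus) (rule has_field_derivative_at_within)
  moreover have "s \<in> interior ?A" using st op by (simp add: interior_open)
  moreover have "t \<in> ?A"
    using st by simp (meson ereal_less_eq(3) le_less_trans)
  ultimately have "- deriv \<phi> s * (t - s) \<le> - \<phi> t - - \<phi> s"
    using is_interval_connected[OF ival] by (intro convex_on_imp_above_tangent) auto
  then show ?thesis by (simp add: algebra_simps)
qed

locale gradient_descent =
  fixes h :: "'a::euclidean_space \<Rightarrow> real" and g :: "'a \<Rightarrow> 'a"
    and \<alpha> c :: real and x :: "nat \<Rightarrow> 'a"
  assumes grad: "GDERIV h z :> g z"
    and cont_grad: "continuous_on UNIV g"
    and step_size: "0 < \<alpha>" and decrease_rate: "0 < c"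
    and step: "x (Suc k) = x k - \<alpha> *\<^sub>R g (x k)"
    and decrease: "h (x (Suc k)) \<le> h (x k) - c * (norm (x (Suc k) - x k))\<^sup>2"
    and bounded_iterates: "bounded (range x)"
begin

lemma norm_step: "norm (x (Suc k) - x k) = \<alpha> * norm (g (x k))"
  using step[of k] step_size by simp

lemma ex_accumulation_point: "\<exists>xs. accumulation_point x xs"
  unfolding accumulation_point_def
  using bounded_imp_convergent_subsequence[OF bounded_iterates] by blast

lemma continuous_objective: "isCont h z"
  using grad[of z] unfolding gderiv_def by (rule has_derivative_continuous)

lemma decseq_values: "decseq (\<lambda>k. h (x k))"
proof (rule decseq_SucI)
  fix k
  have "0 \<le> c * (norm (x (Suc k) - x k))\<^sup>2" using decrease_rate by simp
  then show "h (x (Suc k)) \<le> h (x k)" using decrease[of k] by linarith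
qed

text \<open>A monotone sequence converges as soon as one of its subsequences does.\<close>

lemma values_tendsto:
  assumes "accumulation_point x xs"
  shows "(\<lambda>k. h (x k)) \<longlonglongrightarrow> h xs" and "h xs \<le> h (x k)"
proof -
  obtain r where r: "strict_mono r" "(x \<circ> r) \<longlonglongrightarrow> xs"
    using assms accumulation_point_def by blast
  have sub: "(\<lambda>k. h (x (r k))) \<longlonglongrightarrow> h xs"
    using isCont_tendsto_compose[OF continuous_objective r(2)] by (simp add: o_def)
  have dec_sub: "decseq (\<lambda>k. h (x (r k)))"
    using decseq_values r(1) unfolding decseq_def
    by (simp add: strict_mono_less_eq)
  have le: "h xs \<le> h (x k)" for k
  proof -
    have "h xs \<le> h (x (r k))" by (rule decseq_ge[OF dec_sub sub])
    also have "\<dots> \<le> h (x k)"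
      using decseqD[OF decseq_values seq_suble[OF r(1), of k]] .
    finally show ?thesis .
  qed
  then show "h xs \<le> h (x k)" .
  obtain l where l: "(\<lambda>k. h (x k)) \<longlonglongrightarrow> l"
    using decseq_convergent[OF decseq_values, of "h xs"] le by blast
  then have "(\<lambda>k. h (x (r k))) \<longlonglongrightarrow> l"
    using LIMSEQ_subseq_LIMSEQ[OF l r(1)] by (simp add: o_def)
  then show "(\<lambda>k. h (x k)) \<longlonglongrightarrow> h xs" using l LIMSEQ_unique sub by blast
qed

lemma summable_step_sq: "summable (\<lambda>k. (norm (x (Suc k) - x k))\<^sup>2)"
proof -
  obtain xs where "accumulation_point x xs" using ex_accumulation_point by blast
  then have "summable (\<lambda>k. (h (x k) - h (x (Suc k))) / c)"
    by (intro summable_divide telescope_summable'[OF values_tendsto(1)])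
  moreover have "norm ((norm (x (Suc k) - x k))\<^sup>2) \<le> (h (x k) - h (x (Suc k))) / c" for k
    using decrease[of k] decrease_rate by (simp add: field_simps)
  ultimately show ?thesis by (rule summable_comparison_test')
qed

lemma summable_gradient_sq: "summable (\<lambda>k. (norm (g (x k)))\<^sup>2)"
proof -
  have "(norm (g (x k)))\<^sup>2 = (norm (x (Suc k) - x k))\<^sup>2 / \<alpha>\<^sup>2" for k
    using step_size by (simp add: norm_step power_mult_distrib)
  then show ?thesis using summable_divide[OF summable_step_sq] by simp
qed

lemma accumulation_point_stationary:
  assumes "accumulation_point x xs"
  shows "g xs = 0"
proof -
  obtain r where r: "strict_mono r" "(x \<circ> r) \<longlonglongrightarrow> xs"
    using assms accumulation_point_def by blast
  have "(\<lambda>k. g (x k)) \<longlonglongrightarrow> 0"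
    using summable_LIMSEQ_zero[OF summable_gradient_sq]
    by (simp add: tendsto_norm_zero_iff)
  then have "(\<lambda>k. g (x (r k))) \<longlonglongrightarrow> 0"
    using LIMSEQ_subseq_LIMSEQ[OF _ r(1)] by (force simp: o_def)
  moreover have "(\<lambda>k. g (x (r k))) \<longlonglongrightarrow> g xs"
    using isCont_tendsto_compose[of xs g, OF _ r(2)] cont_grad
    by (simp add: o_def continuous_on_eq_continuous_at)
  ultimately show ?thesis using LIMSEQ_unique by blast
qed

text \<open>
  Since the gradient is a limiting subgradient, the KL inequality bounds \<open>\<phi>'\<close> from below by
  \<open>1 / \<parallel>g\<parallel>\<close>; the length of a step is \<open>\<alpha> \<parallel>g\<parallel>\<close>, so one of the two factors in the decrease
  \<open>c \<parallel>d\<parallel>\<^sup>2\<close> cancels against \<open>\<phi>'\<close>.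
\<close>

lemma KL_step_bound:
  fixes \<eta> :: ereal and \<phi> :: "real \<Rightarrow> real"
  assumes conc: "concave_on {s. 0 \<le> s \<and> ereal s < \<eta>} \<phi>"
    and diff: "\<And>s. 0 < s \<and> ereal s < \<eta> \<Longrightarrow> \<phi> differentiable (at s)"
    and pos: "\<And>s. 0 < s \<and> ereal s < \<eta> \<Longrightarrow> 0 < deriv \<phi> s"
    and KL: "ereal (h xs) < ereal (h (x k)) \<and> ereal (h (x k)) < ereal (h xs) + \<eta> \<Longrightarrow>
        1 \<le> ereal (deriv \<phi> (real_of_ereal (ereal (h (x k)) - ereal (h xs)))) *
          dist_zero (limiting_subdifferential (\<lambda>z. ereal (h z)) (x k))"
    and above: "h xs < h (x (Suc k))" and gap: "ereal (h (x k) - h xs) < \<eta>"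
  shows "c * \<alpha> * norm (x (Suc k) - x k) \<le> \<phi> (h (x k) - h xs) - \<phi> (h (x (Suc k)) - h xs)"
proof -
  let ?e = "\<lambda>k. h (x k) - h xs" and ?d = "norm (x (Suc k) - x k)"
  have le: "h (x (Suc k)) \<le> h (x k)" using decseqD[OF decseq_values, of k "Suc k"] by simp
  have e: "0 < ?e k \<and> ereal (?e k) < \<eta>" using above le gap by simp
  have "ereal (h (x k)) < ereal (h xs) + \<eta>" using gap by (cases \<eta>) auto
  then have "1 \<le> ereal (deriv \<phi> (?e k)) *
      dist_zero (limiting_subdifferential (\<lambda>z. ereal (h z)) (x k))"
    using KL e by simp
  also have "\<dots> \<le> ereal (deriv \<phi> (?e k)) * ereal (norm (g (x k)))"
    unfolding dist_zero_def
    using pos[OF e] by (intro ereal_mult_left_mono INF_lower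
        gradient_in_limiting_subdifferential grad) auto
  finally have "1 \<le> deriv \<phi> (?e k) * norm (g (x k))" by (simp add: one_ereal_def)
  then have "\<alpha> \<le> deriv \<phi> (?e k) * ?d"
    using mult_left_mono[of 1 _ \<alpha>] step_size by (simp add: norm_step mult.left_commute)
  then have "c * ?d * \<alpha> \<le> c * ?d * (deriv \<phi> (?e k) * ?d)"
    using decrease_rate by (intro mult_left_mono) auto
  also have "\<dots> = deriv \<phi> (?e k) * (c * ?d\<^sup>2)" by (simp add: power2_eq_square)
  also have "\<dots> \<le> deriv \<phi> (?e k) * (?e k - ?e (Suc k))"
    using decrease[of k] pos[OF e] by (intro mult_left_mono) auto
  also have "\<dots> \<le> \<phi> (?e k) - \<phi> (?e (Suc k))"
    using above le e by (intro concave_deriv_mult_diff_le[OF conc diff]) auto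
  finally show ?thesis by (simp add: mult.commute mult.left_commute)
qed

text \<open>
  The KL inequality says nothing about points with zero gap. If an iterate attains the limit value,
  however, no decrease is left to pay for a further step.
\<close>

lemma constant_after_attaining_limit_value:
  assumes acc: "accumulation_point x xs" and N: "h (x N) = h xs" and "N \<le> k"
  shows "x k = x N"
  using \<open>N \<le> k\<close>
proof (induction k rule: dec_induct)
  case (step n)
  have "h xs = h (x n)" "h xs \<le> h (x (Suc n))"
    using values_tendsto(2)[OF acc] N step.IH by auto
  then have "c * (norm (x (Suc n) - x n))\<^sup>2 \<le> 0" using decrease[of n] by simp
  then have "x (Suc n) = x n" using decrease_rate by (simp add: mult_le_0_iff)
  then show ?case using step.IH by simp
qed simp

text \<open>
  Start at an iterate \<open>N\<close> within \<open>r/2\<close> of \<open>xs\<close> for which \<open>\<phi>(e\<^sub>N) < c \<alpha> r/2\<close>. As long as the iterates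
  stay in the ball of radius \<open>r\<close>, the step bounds telescope to a path of length at most
  \<open>\<phi>(e\<^sub>N) / (c \<alpha>) < r/2\<close>, which keeps the next iterate in that ball too.
\<close>

lemma KL_imp_convergent:
  assumes acc: "accumulation_point x xs" and KL: "KL_property (\<lambda>z. ereal (h z)) xs"
  shows "x \<longlonglongrightarrow> xs"
proof (cases "\<exists>N. h (x N) = h xs")
  case True
  then obtain N where N: "h (x N) = h xs" by blast
  have "\<forall>\<^sub>F k in sequentially. x k = x N"
    by (rule eventually_sequentiallyI[of N]) (rule constant_after_attaining_limit_value[OF acc N])
  then have lim: "x \<longlonglongrightarrow> x N" by (rule tendsto_eventually)
  obtain r where "strict_mono r" "(x \<circ> r) \<longlonglongrightarrow> xs"
    using acc accumulation_point_def by blast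
  then have "xs = x N" using LIMSEQ_subseq_LIMSEQ[OF lim, of r] LIMSEQ_unique by blast
  then show ?thesis using lim by simp
next
  case False
  then have above: "h xs < h (x k)" for k
    using values_tendsto(2)[OF acc, of k] by (metis order_le_less)
  obtain \<eta> :: ereal and U and \<phi> :: "real \<Rightarrow> real" where
    eta: "0 < \<eta>" and U: "open U" "xs \<in> U"
    and cont: "continuous_on {s. 0 \<le> s \<and> ereal s < \<eta>} \<phi>"
    and conc: "concave_on {s. 0 \<le> s \<and> ereal s < \<eta>} \<phi>"
    and nonneg: "\<And>s. 0 \<le> s \<and> ereal s < \<eta> \<Longrightarrow> 0 \<le> \<phi> s"
    and zero: "\<phi> 0 = 0"
    and diff: "\<And>s. 0 < s \<and> ereal s < \<eta> \<Longrightarrow> \<phi> differentiable (at s)"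
    and pos: "\<And>s. 0 < s \<and> ereal s < \<eta> \<Longrightarrow> 0 < deriv \<phi> s"
    and ineq: "\<And>z. z \<in> U \<Longrightarrow> ereal (h xs) < ereal (h z) \<and> ereal (h z) < ereal (h xs) + \<eta> \<Longrightarrow>
        1 \<le> ereal (deriv \<phi> (real_of_ereal (ereal (h z) - ereal (h xs)))) *
          dist_zero (limiting_subdifferential (\<lambda>z. ereal (h z)) z)"
    using KL unfolding KL_property_def by blast
  define e where "e k = h (x k) - h xs" for k
  have e_pos: "0 < e k" for k using above by (simp add: e_def)
  have e_lim: "e \<longlonglongrightarrow> 0"
    unfolding e_def using tendsto_diff[OF values_tendsto(1)[OF acc] tendsto_const[of "h xs"]] by simp
  have "(\<lambda>k. ereal (e k)) \<longlonglongrightarrow> 0" using e_lim by (simp add: zero_ereal_def)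
  then have "\<forall>\<^sub>F k in sequentially. ereal (e k) < \<eta>" using eta by (rule order_tendstoD)
  then obtain K where e_eta: "\<And>k. K \<le> k \<Longrightarrow> ereal (e k) < \<eta>"
    unfolding eventually_sequentially by blast
  have "\<forall>\<^sub>F k in sequentially. e k \<in> {s. 0 \<le> s \<and> ereal s < \<eta>}"
    using e_eta e_pos less_imp_le unfolding eventually_sequentially by blast
  then have "(\<lambda>k. \<phi> (e k)) \<longlonglongrightarrow> \<phi> 0"
    using eta by (intro continuous_on_tendsto_compose[OF cont e_lim]) (auto simp: zero_ereal_def)
  then have phi_lim: "(\<lambda>k. \<phi> (e k)) \<longlonglongrightarrow> 0" using zero by simp
  obtain \<rho> where rho: "0 < \<rho>" "ball xs \<rho> \<subseteq> U" using U open_contains_ball by blast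
  obtain s where s: "strict_mono s" "(x \<circ> s) \<longlonglongrightarrow> xs"
    using acc accumulation_point_def by blast
  show ?thesis
  proof (rule LIMSEQ_I)
    fix \<epsilon> :: real assume "0 < \<epsilon>"
    define r where "r = min \<epsilon> \<rho>"
    have r: "0 < r" using \<open>0 < \<epsilon>\<close> rho by (simp add: r_def)
    have ca: "0 < c * \<alpha>" using decrease_rate step_size by simp
    have "\<forall>\<^sub>F k in sequentially. \<phi> (e (s k)) < c * \<alpha> * (r / 2)"
      using LIMSEQ_subseq_LIMSEQ[OF phi_lim s(1)] ca r
      by (intro order_tendstoD(2)) (auto simp: o_def)
    moreover have "\<forall>\<^sub>F k in sequentially. dist (x (s k)) xs < r / 2"
      using tendstoD[OF s(2), of "r / 2"] r by simp
    moreover have "\<forall>\<^sub>F k in sequentially. K \<le> s k"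
      using seq_suble[OF s(1)] le_trans unfolding eventually_sequentially by blast
    ultimately have "\<forall>\<^sub>F k in sequentially.
        \<phi> (e (s k)) < c * \<alpha> * (r / 2) \<and> dist (x (s k)) xs < r / 2 \<and> K \<le> s k"
      by (intro eventually_conj)
    then obtain N where N: "\<phi> (e N) < c * \<alpha> * (r / 2)" "dist (x N) xs < r / 2" "K \<le> N"
      unfolding eventually_sequentially by blast
    have trapped: "norm (x k - xs) < r \<and> c * \<alpha> * norm (x k - x N) \<le> \<phi> (e N) - \<phi> (e k)"
      if "N \<le> k" for k
      using that
    proof (induction k rule: dec_induct)
      case base
      then show ?case using N(2) r by (simp add: dist_norm)
    next
      case (step k)
      have "x k \<in> U"
        using step.IH rho(2) by (auto simp: r_def dist_norm norm_minus_commute subset_iff)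
      then have "c * \<alpha> * norm (x (Suc k) - x k) \<le> \<phi> (e k) - \<phi> (e (Suc k))"
        unfolding e_def using above e_eta[of k] step.hyps N(3)
        by (intro KL_step_bound[OF conc diff pos ineq]) (auto simp: e_def)
      moreover have "norm (x (Suc k) - x N) \<le> norm (x (Suc k) - x k) + norm (x k - x N)"
        using norm_triangle_ineq[of "x (Suc k) - x k" "x k - x N"] by simp
      then have "c * \<alpha> * norm (x (Suc k) - x N) \<le>
          c * \<alpha> * norm (x (Suc k) - x k) + c * \<alpha> * norm (x k - x N)"
        unfolding distrib_left[symmetric] using ca by (intro mult_left_mono) auto
      ultimately have path: "c * \<alpha> * norm (x (Suc k) - x N) \<le> \<phi> (e N) - \<phi> (e (Suc k))"
        using step.IH by linarith
      moreover have "0 \<le> \<phi> (e (Suc k))"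
        using e_pos[of "Suc k"] e_eta[of "Suc k"] step.hyps N(3) by (intro nonneg) auto
      ultimately have "c * \<alpha> * norm (x (Suc k) - x N) < c * \<alpha> * (r / 2)"
        using N(1) by linarith
      then have "norm (x (Suc k) - x N) < r / 2" using ca mult_less_cancel_left_pos by blast
      moreover have "norm (x (Suc k) - xs) \<le> norm (x (Suc k) - x N) + norm (x N - xs)"
        using norm_triangle_ineq[of "x (Suc k) - x N" "x N - xs"] by simp
      ultimately have "norm (x (Suc k) - xs) < r" using N(2) by (simp add: dist_norm)
      then show ?case using path by blast
    qed
    show "\<exists>no. \<forall>k\<ge>no. norm (x k - xs) < \<epsilon>"
      using trapped by (intro exI[of _ N]) (auto simp: r_def)
  qed
qed

end

section \<open>The Lyapunov function of decentralized gradient descent\<close>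

lemma GDERIV_sum_rows:
  fixes f :: "'n::finite \<Rightarrow> real^'p \<Rightarrow> real"
  assumes "\<And>i u. GDERIV (f i) u :> gradient (f i) u"
  shows "GDERIV (\<lambda>X. \<Sum>i\<in>UNIV. f i (X $ i)) X :> stacked_gradient f X"
proof -
  have "((\<lambda>X. f i (X $ i)) has_derivative (\<lambda>V. (V $ i) \<bullet> gradient (f i) (X $ i))) (at X)" for i
    using has_derivative_compose[OF bounded_linear_imp_has_derivative[OF bounded_linear_vec_nth[of i]]
        assms[of i "X $ i", unfolded gderiv_def]] .
  then have "((\<lambda>X. \<Sum>i\<in>UNIV. f i (X $ i)) has_derivative
      (\<lambda>V. \<Sum>i\<in>UNIV. (V $ i) \<bullet> gradient (f i) (X $ i))) (at X)"
    by (rule has_derivative_sum)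
  then show ?thesis
    unfolding gderiv_def by (simp add: inner_vec_def stacked_gradient_def)
qed

lemma GDERIV_lyapunov:
  fixes f :: "'n::finite \<Rightarrow> real^'p \<Rightarrow> real"
  assumes grad: "\<And>i u. GDERIV (f i) u :> gradient (f i) u"
    and sym: "transpose W = W"
  shows "GDERIV (lyapunov W f \<alpha>) X :>
    stacked_gradient f X + (1 / \<alpha>) *\<^sub>R ((mat 1 - W) ** X)"
proof -
  have "(weighted_norm_sq (mat 1 - W) has_derivative
      (\<lambda>V. V \<bullet> (2 *\<^sub>R ((mat 1 - W) ** X)))) (at X)"
    using GDERIV_weighted_norm_sq[OF transpose_mat_1_minus[OF sym]] unfolding gderiv_def .
  then have "((\<lambda>X. 1 / (2 * \<alpha>) * weighted_norm_sq (mat 1 - W) X) has_derivative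
      (\<lambda>V. 1 / (2 * \<alpha>) * (V \<bullet> (2 *\<^sub>R ((mat 1 - W) ** X))))) (at X)"
    by (rule has_derivative_mult_right)
  then have "((\<lambda>X. (\<Sum>i\<in>UNIV. f i (X $ i)) + 1 / (2 * \<alpha>) * weighted_norm_sq (mat 1 - W) X)
      has_derivative (\<lambda>V. V \<bullet> stacked_gradient f X +
        1 / (2 * \<alpha>) * (V \<bullet> (2 *\<^sub>R ((mat 1 - W) ** X))))) (at X)"
    using GDERIV_sum_rows[OF grad] unfolding gderiv_def by (intro has_derivative_add)
  then show ?thesis
    unfolding gderiv_def lyapunov_def by (simp add: inner_add_right)
qed

text \<open>
  Each summand is bounded below, being coercive and continuous. An upper bound on the sum is
  therefore an upper bound on every single summand, which confines the corresponding row.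
\<close>

lemma bounded_sublevel_sum_rows:
  fixes f :: "'n::finite \<Rightarrow> real^'p \<Rightarrow> real"
  assumes coer: "\<And>i. coercive (f i)" and cont: "\<And>i. continuous_on UNIV (f i)"
  shows "bounded {X :: real^'p^'n. (\<Sum>i\<in>UNIV. f i (X $ i)) \<le> C}"
proof -
  have outside: "\<exists>B. \<forall>u. f i u \<le> Z \<longrightarrow> norm u \<le> B" for i Z
  proof -
    have "\<forall>\<^sub>F u in at_infinity. Z + 1 \<le> f i u"
      using coer[of i] unfolding coercive_def filterlim_at_top by blast
    then obtain B where B: "\<And>u. B \<le> norm u \<Longrightarrow> Z + 1 \<le> f i u"
      unfolding eventually_at_infinity by blast
    show ?thesis
    proof (intro exI allI impI)
      fix u assume "f i u \<le> Z"
      then have "\<not> B \<le> norm u" using B[of u] by linarith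
      then show "norm u \<le> B" by simp
    qed
  qed
  have "\<exists>m. \<forall>u. m \<le> f i u" for i
  proof -
    obtain B where B: "\<And>u. f i u \<le> 0 \<Longrightarrow> norm u \<le> B" using outside by blast
    have "bounded (f i ` cball 0 B)"
      by (intro compact_imp_bounded compact_continuous_image continuous_on_subset[OF cont]) auto
    then obtain M where "\<forall>y \<in> f i ` cball 0 B. norm y \<le> M" unfolding bounded_iff ..
    then have M: "\<bar>f i u\<bar> \<le> M" if "u \<in> cball 0 B" for u using that by simp
    have "min 0 (- M) \<le> f i u" for u
    proof (cases "f i u \<le> 0")
      case True
      then have "\<bar>f i u\<bar> \<le> M" by (intro M) (simp add: B)
      then show ?thesis by linarith
    qed simp
    then show ?thesis by blast
  qed
  then obtain m where m: "\<And>i u. m i \<le> f i u" by metis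
  define Z where "Z i = C - sum m (UNIV - {i})" for i
  have "\<forall>i. \<exists>B. \<forall>u. f i u \<le> Z i \<longrightarrow> norm u \<le> B" using outside by blast
  then obtain B where B: "\<And>i u. f i u \<le> Z i \<Longrightarrow> norm u \<le> B i" by metis
  have "norm X \<le> sum B UNIV" if "(\<Sum>i\<in>UNIV. f i (X $ i)) \<le> C" for X :: "real^'p^'n"
  proof -
    have "norm (X $ i) \<le> B i" for i
    proof (rule B)
      have "sum m (UNIV - {i}) \<le> (\<Sum>j\<in>UNIV - {i}. f j (X $ j))" using m by (rule sum_mono)
      moreover have "(\<Sum>j\<in>UNIV. f j (X $ j)) = f i (X $ i) + (\<Sum>j\<in>UNIV - {i}. f j (X $ j))"
        by (rule sum.remove) auto
      ultimately show "f i (X $ i) \<le> Z i" using that by (simp add: Z_def)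
    qed
    moreover have "norm X \<le> (\<Sum>i\<in>UNIV. norm (X $ i))"
      unfolding norm_vec_def by (rule L2_set_le_sum) simp
    ultimately show ?thesis by (meson order_trans sum_mono)
  qed
  then show ?thesis unfolding bounded_iff by blast
qed

lemma continuous_on_stacked_gradient:
  fixes f :: "'n::finite \<Rightarrow> real^'p \<Rightarrow> real"
  assumes "\<And>i. continuous_on UNIV (gradient (f i))"
  shows "continuous_on UNIV (stacked_gradient f)"
  unfolding stacked_gradient_def
proof (rule continuous_on_vec_lambda)
  show "continuous_on UNIV (\<lambda>X :: real^'p^'n. gradient (f i) (X $ i))" for i
    by (rule continuous_on_compose2[OF assms]) (auto intro!: continuous_intros)
qed

text \<open>
  With \<open>d = Y - X\<close>, the row functions exceed their linearization by at most \<open>M/2 \<parallel>d\<parallel>\<^sup>2\<close>, while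
  the quadratic part is expanded exactly. Since \<open>\<nabla>\<L>\<^sub>\<alpha>(X) = -d/\<alpha>\<close>, the linear terms add up to
  \<open>-\<parallel>d\<parallel>\<^sup>2/\<alpha>\<close>, and the quadratic remainder \<open>\<langle>d, (I - W) d\<rangle> / (2 \<alpha>)\<close> leaves
  \<open>-\<langle>d, (I + W) d\<rangle> / (2 \<alpha>)\<close> of them, which is at most \<open>-(1 + \<lambda>\<^sub>n) \<parallel>d\<parallel>\<^sup>2 / (2 \<alpha>)\<close>.
\<close>

lemma lyapunov_sufficient_decrease:
  fixes f :: "'n::finite \<Rightarrow> real^'p \<Rightarrow> real"
  assumes grad: "\<And>i u. GDERIV (f i) u :> gradient (f i) u"
    and lip: "\<And>i. (L i)-lipschitz_on UNIV (gradient (f i))"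
    and Lmax: "\<And>i. L i \<le> M"
    and sym: "transpose W = W" and \<alpha>: "0 < \<alpha>"
    and Y: "Y = W ** X - \<alpha> *\<^sub>R stacked_gradient f X"
  shows "lyapunov W f \<alpha> Y \<le>
    lyapunov W f \<alpha> X - (1 + lambda_min W - \<alpha> * M) / (2 * \<alpha>) * (norm (Y - X))\<^sup>2"
proof -
  define D where "D = Y - X"
  let ?G = "stacked_gradient f X" and ?q = "weighted_norm_sq (mat 1 - W)"
  have rows: "(\<Sum>i\<in>UNIV. f i (Y $ i)) \<le> (\<Sum>i\<in>UNIV. f i (X $ i)) + D \<bullet> ?G + M / 2 * (norm D)\<^sup>2"
  proof -
    have "f i (Y $ i) \<le> f i (X $ i) + (D $ i) \<bullet> (?G $ i) + M / 2 * ((D $ i) \<bullet> (D $ i))" for i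
    proof -
      have "L i / 2 * (norm (D $ i))\<^sup>2 \<le> M / 2 * (norm (D $ i))\<^sup>2"
        using Lmax by (intro mult_right_mono) auto
      then show ?thesis
        using lipschitz_gradient_descent_lemma[OF grad lip, of i "Y $ i" "X $ i"]
        by (simp add: D_def stacked_gradient_def power2_norm_eq_inner)
    qed
    then have "(\<Sum>i\<in>UNIV. f i (Y $ i)) \<le>
        (\<Sum>i\<in>UNIV. f i (X $ i) + (D $ i) \<bullet> (?G $ i) + M / 2 * ((D $ i) \<bullet> (D $ i)))"
      by (rule sum_mono)
    then show ?thesis
      by (simp only: sum.distrib power2_norm_eq_inner flip: sum_distrib_left inner_vec_def)
  qed
  have quad: "?q Y = ?q X + 2 * (D \<bullet> ((mat 1 - W) ** X)) + ?q D"
    using weighted_norm_sq_add[OF transpose_mat_1_minus[OF sym], of X D] by (simp add: D_def)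
  have D: "(mat 1 - W) ** X = - D - \<alpha> *\<^sub>R ?G" by (simp add: mat_1_minus_mult D_def Y)
  have inner_D: "D \<bullet> ((mat 1 - W) ** X) = - (norm D)\<^sup>2 - \<alpha> * (D \<bullet> ?G)"
    unfolding D by (simp add: inner_diff_right power2_norm_eq_inner)
  have qD: "?q D = (norm D)\<^sup>2 - D \<bullet> (W ** D)"
    by (simp add: weighted_norm_sq_def mat_1_minus_mult inner_diff_right power2_norm_eq_inner)
  have "lyapunov W f \<alpha> Y \<le> (\<Sum>i\<in>UNIV. f i (X $ i)) + D \<bullet> ?G + M / 2 * (norm D)\<^sup>2
      + 1 / (2 * \<alpha>) * (?q X + 2 * (- (norm D)\<^sup>2 - \<alpha> * (D \<bullet> ?G)) + ((norm D)\<^sup>2 - D \<bullet> (W ** D)))"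
    unfolding lyapunov_def quad inner_D qD using rows by simp
  also have "\<dots> = lyapunov W f \<alpha> X - ((norm D)\<^sup>2 + D \<bullet> (W ** D) - \<alpha> * M * (norm D)\<^sup>2) / (2 * \<alpha>)"
    unfolding lyapunov_def using \<alpha> by (simp add: field_simps)
  also have "\<dots> \<le> lyapunov W f \<alpha> X -
      ((norm D)\<^sup>2 + lambda_min W * (norm D)\<^sup>2 - \<alpha> * M * (norm D)\<^sup>2) / (2 * \<alpha>)"
    using lambda_min_frobenius_le[OF sym, of D] \<alpha>
    by (intro diff_left_mono divide_right_mono) auto
  finally show ?thesis unfolding D_def by (simp add: algebra_simps)
qed

text \<open>
  For \<open>A = I - W\<close> and \<open>b = 1/\<alpha>\<close>, the right-hand side is the norm of \<open>\<nabla>\<L>\<^sub>\<alpha>\<close>. The columns of \<open>A\<close> sum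
  to zero, so the penalty term disappears when the rows of \<open>\<nabla>\<L>\<^sub>\<alpha>\<close> are averaged, and averaging does
  not increase the norm.
\<close>

lemma norm_average_gradient_le:
  fixes f :: "'n::finite \<Rightarrow> real^'p \<Rightarrow> real" and X :: "real^'p^'n"
  assumes sym: "transpose A = A" and ones: "A *v 1 = 0"
  shows "norm (average_gradient f X) \<le> norm (stacked_gradient f X + b *\<^sub>R (A ** X))"
proof -
  let ?G = "stacked_gradient f X" and ?V = "stacked_gradient f X + b *\<^sub>R (A ** X)"
  have "1 v* A = 0" using ones sym by (metis transpose_matrix_vector)
  then have "1 v* (A ** X) = 0" by (simp flip: vector_matrix_mul_assoc)
  moreover have "1 v* Z = (\<Sum>i\<in>UNIV. Z $ i)" for Z :: "real^'p^'n"
    by (simp add: vector_matrix_mult_def vec_eq_iff)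
  ultimately have "1 v* ?G = (\<Sum>i\<in>UNIV. ?V $ i)"
    by (simp add: sum.distrib flip: scaleR_sum_right)
  then have "norm (1 v* ?G) \<le> (\<Sum>i\<in>UNIV. norm (?V $ i))"
    by (simp only: norm_sum)
  also have "\<dots> \<le> (\<Sum>i\<in>(UNIV :: 'n set). norm ?V)" by (intro sum_mono Finite_Cartesian_Product.norm_nth_le)
  also have "\<dots> = real CARD('n) * norm ?V" by simp
  finally show ?thesis
    by (simp add: average_gradient_def field_simps)
qed

theorem theorem1:
  fixes E :: "('n::finite \<times> 'n) set"
    and W :: "real^'n^'n"
    and f :: "'n \<Rightarrow> real^'p \<Rightarrow> real"
    and L :: "'n \<Rightarrow> real"
    and \<alpha> :: real
    and x :: "nat \<Rightarrow> real^'p^'n"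
  assumes "connected_undirected_graph E"
    and "mixing_matrix E W"
    and "\<And>i. coercive (f i)"
    and "\<And>i u. f i differentiable (at u)"
    and "\<And>i. L i > 0"
    and "\<And>i. (L i)-lipschitz_on UNIV (gradient (f i))"
    and "0 < \<alpha>" and "\<alpha> < (1 + lambda_min W) / Max (range L)"
    and "dgd_sequence W f \<alpha> x"
  shows "((\<exists>xs. accumulation_point x xs) \<and>
          (\<forall>xs. accumulation_point x xs \<longrightarrow> gradient (lyapunov W f \<alpha>) xs = 0)) \<and>
         (running_best_rate_o_inverse (\<lambda>k. (norm (x (Suc k) - x k))\<^sup>2) \<and>
          running_best_rate_o_inverse (\<lambda>k. (norm (gradient (lyapunov W f \<alpha>) (x k)))\<^sup>2) \<and>
          running_best_rate_o_inverse (\<lambda>k. (norm (average_gradient f (x k)))\<^sup>2)) \<and>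
         (\<lambda>K. 1 / real K * (\<Sum>k<K. (norm (average_gradient f (x k)))\<^sup>2)) \<in> O(\<lambda>K. 1 / real K) \<and>
         (\<forall>xs. accumulation_point x xs \<and> KL_property (\<lambda>z. ereal (lyapunov W f \<alpha> z)) xs
            \<longrightarrow> x \<longlonglongrightarrow> xs)"
proof -
  have W: "transpose W = W" "pos_semidef (mat 1 - W)" "{v. (mat 1 - W) *v v = 0} = span {1}"
    using assms(2) unfolding mixing_matrix_def by auto
  have grad: "GDERIV (f i) u :> gradient (f i) u" for i u
    using assms(4) by (rule differentiable_imp_GDERIV)
  define M where "M = Max (range L)"
  have LM: "L i \<le> M" for i unfolding M_def by (intro Max_ge) auto
  then have "0 < M" using assms(5) less_le_trans by blast
  define c where "c = (1 + lambda_min W - \<alpha> * M) / (2 * \<alpha>)"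
  have c: "0 < c"
    using assms(7,8) \<open>0 < M\<close> unfolding c_def M_def[symmetric] by (simp add: field_simps)
  define h where "h = lyapunov W f \<alpha>"
  define g where "g X = stacked_gradient f X + (1 / \<alpha>) *\<^sub>R ((mat 1 - W) ** X)" for X
  have h_grad: "GDERIV h X :> g X" for X
    unfolding h_def g_def by (rule GDERIV_lyapunov[OF grad W(1)])
  have x_step: "x (Suc k) = W ** x k - \<alpha> *\<^sub>R stacked_gradient f (x k)" for k
    using assms(9) unfolding dgd_sequence_def by blast
  have h_decrease: "h (x (Suc k)) \<le> h (x k) - c * (norm (x (Suc k) - x k))\<^sup>2" for k
    unfolding h_def c_def
    by (rule lyapunov_sufficient_decrease[OF grad assms(6) LM W(1) assms(7) x_step])
  have x_bounded: "bounded (range x)"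
  proof (rule bounded_subset)
    have "continuous_on UNIV (f i)" for i
      using assms(4) by (auto intro!: continuous_at_imp_continuous_on
          differentiable_imp_continuous_within)
    then show "bounded {X :: real^'p^'n. (\<Sum>i\<in>UNIV. f i (X $ i)) \<le> h (x 0)}"
      using assms(3) by (intro bounded_sublevel_sum_rows)
    have "h (x k) \<le> h (x 0)" for k
    proof (induction k)
      case (Suc k)
      have "0 \<le> c * (norm (x (Suc k) - x k))\<^sup>2" using c by simp
      then show ?case using h_decrease[of k] Suc by linarith
    qed simp
    moreover have "(\<Sum>i\<in>UNIV. f i (x k $ i)) \<le> h (x k)" for k
      using weighted_norm_sq_nonneg[OF W(2)] assms(7) by (simp add: h_def lyapunov_def zero_le_divide_iff)
    ultimately show "range x \<subseteq> {X. (\<Sum>i\<in>UNIV. f i (X $ i)) \<le> h (x 0)}"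
      using order_trans by blast
  qed
  interpret gradient_descent h g \<alpha> c x
  proof
    show "GDERIV h z :> g z" for z by (rule h_grad)
    have "continuous_on UNIV (\<lambda>X :: real^'p^'n. (mat 1 - W) ** X)"
      by (intro linear_continuous_on linear_conv_bounded_linear[THEN iffD1]
          linear_matrix_matrix_mult)
    then show "continuous_on UNIV g"
      unfolding g_def using assms(6) lipschitz_on_continuous_on
      by (intro continuous_intros continuous_on_stacked_gradient) auto
    show "x (Suc k) = x k - \<alpha> *\<^sub>R g (x k)" for k
      using assms(7) by (simp add: x_step g_def scaleR_right_distrib mat_1_minus_mult)
  qed (use assms(7) c h_decrease x_bounded in auto)
  have gradient_h: "gradient (lyapunov W f \<alpha>) X = g X" for X
    using gradient_eq[OF h_grad] by (simp add: h_def)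
  have average_le: "norm (average_gradient f X) \<le> norm (g X)" for X
    unfolding g_def
  proof (rule norm_average_gradient_le)
    show "transpose (mat 1 - W) = mat 1 - W" by (rule transpose_mat_1_minus[OF W(1)])
    have "1 \<in> span {1 :: real^'n}" by (rule span_base) simp
    then show "(mat 1 - W) *v 1 = 0" using W(3) by blast
  qed
  have average: "summable (\<lambda>k. (norm (average_gradient f (x k)))\<^sup>2)"
    by (rule summable_comparison_test'[OF summable_gradient_sq]) (simp add: average_le power_mono)
  have "(\<exists>xs. accumulation_point x xs) \<and>
      (\<forall>xs. accumulation_point x xs \<longrightarrow> gradient (lyapunov W f \<alpha>) xs = 0)"
    using ex_accumulation_point accumulation_point_stationary by (simp add: gradient_h)
  moreover have "running_best_rate_o_inverse (\<lambda>k. (norm (x (Suc k) - x k))\<^sup>2) \<and>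
      running_best_rate_o_inverse (\<lambda>k. (norm (gradient (lyapunov W f \<alpha>) (x k)))\<^sup>2) \<and>
      running_best_rate_o_inverse (\<lambda>k. (norm (average_gradient f (x k)))\<^sup>2)"
    using summable_step_sq summable_gradient_sq average
    by (simp add: gradient_h summable_imp_running_best_rate)
  moreover have "(\<lambda>K. 1 / real K * (\<Sum>k<K. (norm (average_gradient f (x k)))\<^sup>2))
      \<in> O(\<lambda>K. 1 / real K)"
    using average by (intro summable_imp_average_bigo) auto
  moreover have "\<forall>xs. accumulation_point x xs \<and>
      KL_property (\<lambda>z. ereal (lyapunov W f \<alpha> z)) xs \<longrightarrow> x \<longlonglongrightarrow> xs"
    using KL_imp_convergent unfolding h_def by blast
  ultimately show ?thesis by blast
qed

end
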